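(* Let $g$ be a Clifford logical operator of an $[[n,k]]$ CSS code whose action on the logical Pauli group $\overline{\mathcal P}_k$ is given by the matrix $M_g^{(L)}\in \mathrm{GL}(2k,\mathbb F_2)$, and assume that $g$ fixes the stabilizers pointwise, i.e. $M_g^{(S)}=I_{n-k}$. Let $L'=(M_g^{(L)}+I_{2k})L$ and define the $n\times n$ binary matrices $$A_g=I+\sum_{i=1}^k l_{i,Z}^{\top}L'(i,1:n),\qquad B_g=\sum_{i=1}^k l_{i,Z}^{\top}L'(i,n+1:2n),$$ $$C_g=\sum_{i=1}^k l_{i,X}^{\top}L'(k+i,1:n),\qquad D_g=I+\sum_{i=1}^k l_{i,X}^{\top}L'(k+i,n+1:2n).$$ Then $F_g=\begin{bmatrix}A_g&B_g\\ C_g&D_g\end{bmatrix}$ is a valid symplectic matrix for the logical operation $g$; that is, $F_g\in Sp(2n,\mathbb F_2)$, $LF_g=M_g^{(L)}L$, and $HF_g=H$.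
   Context: All vectors are row vectors over $\mathbb F_2$; $M(i,a:b)$ is the part of row $i$ of $M$ in columns $a,\dots,b$. Let $\Omega=\begin{bmatrix}0 & I_n \\ I_n & 0\end{bmatrix}$, $(x,y)_s=x\Omega y^{\top}$ for $x,y\in\mathbb F_2^{2n}$, and $Sp(2n,\mathbb F_2)=\{F: F\Omega F^{\top}=\Omega\}$. For $a,b\in\mathbb F_2^n$ let $D(a,b)=X^{a_1}Z^{b_1}\otimes\cdots\otimes X^{a_n}Z^{b_n}$; the $n$-qubit Pauli group is $\mathcal P_n=\{i^{\kappa}D(a,b)\}$, and $\phi(i^\kappa D(a,b))=[a,b]\in\mathbb F_2^{2n}$. An $[[n,k]]$ CSS code is given by binary matrices $H_X$ ($m_X\times n$) and $H_Z$ ($m_Z\times n$) with $H_XH_Z^{\top}=0$, with linearly independent rows in each, $m_X+m_Z=n-k$. Its stabilizer group $\mathcal S$ is generated by $D(H_X(i,:),0)$ and $D(0,H_Z(i,:))$. Put $H=\begin{bmatrix}H_X&0\\0&H_Z\end{bmatrix}$. Logical Paulis: fix vectors $l_{1,X},\dots,l_{k,X}\in\ker H_Z$ representing a basis of $\ker(H_Z)/\mathrm{Im}(H_X^{\top})$ and $l_{1,Z},\dots,l_{k,Z}\in\ker H_X$ representing a basis of $\ker(H_X)/\mathrm{Im}(H_Z^{\top})$, with $l_{i,X}l_{j,Z}^{\top}=\delta_{ij}$. Let $\overline X_i=D(l_{i,X},0)$, $\overline Z_i=D(0,l_{i,Z})$, and let $\overline{\mathcal P}_k$ be the group they generate. $L$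 is the $2k\times 2n$ matrix whose rows $1,\dots,k$ are $\phi(\overline X_i)=[l_{i,X},0]$ and rows $k+1,\dots,2k$ are $\phi(\overline Z_i)=[0,l_{i,Z}]$. A Clifford logical operator $g$ is an $n$-qubit Clifford unitary whose conjugation action normalizes $\mathcal S$ and $\overline{\mathcal P}_k$ (global phases ignored). Its action on $\overline{\mathcal P}_k$ is described by the invertible matrix $M_g^{(L)}$: $\phi(g\overline X_ig^\dagger)$ is row $i$ and $\phi(g\overline Z_ig^\dagger)$ is row $k+i$ of $M_g^{(L)}L$. Its action on the stabilizers is described by the invertible $(n-k)\times(n-k)$ matrix $M_g^{(S)}$: the $\phi$-images of the conjugated stabilizer generators are the rows of $M_g^{(S)}H$. A matrix $F\in Sp(2n,\mathbb F_2)$ is a valid symplectic matrix for $g$ if $LF=M_g^{(L)}L$ and $HF=M_g^{(S)}H$. *)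

theory Defs
  imports
    "Jordan_Normal_Form.Schur_Decomposition"
    "Jordan_Normal_Form.Matrix_Kernel"
    "HOL-Library.Z2"
    "HOL-Algebra.Generated_Groups"
begin

text \<open>Vectors and matrices over the two-element field have entry type \<^typ>\<open>bit\<close>.
  All indices start at 0, and qubit operators are complex matrices of size \<open>2^n\<close>.
  A row vector is a \<^typ>\<open>bit vec\<close>; the concatenation \<open>[a, b]\<close> is \<open>a @\<^sub>v b\<close>.\<close>

definition symp_form :: "nat \<Rightarrow> bit mat" where
  "symp_form n = four_block_mat (0\<^sub>m n n) (1\<^sub>m n) (1\<^sub>m n) (0\<^sub>m n n)"

definition Sp :: "nat \<Rightarrow> bit mat set" where
  "Sp n = {F \<in> carrier_mat (2 * n) (2 * n). F * symp_form n * transpose_mat F = symp_form n}"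

definition kron :: "complex mat \<Rightarrow> complex mat \<Rightarrow> complex mat" where
  "kron A B = mat (dim_row A * dim_row B) (dim_col A * dim_col B)
     (\<lambda>(i, j). A $$ (i div dim_row B, j div dim_col B) * B $$ (i mod dim_row B, j mod dim_col B))"

definition pauli_X :: "complex mat" where
  "pauli_X = mat_of_rows_list 2 [[0, 1], [1, 0]]"

definition pauli_Z :: "complex mat" where
  "pauli_Z = mat_of_rows_list 2 [[1, 0], [0, -1]]"

definition mat_pow_bit :: "complex mat \<Rightarrow> bit \<Rightarrow> complex mat" where
  "mat_pow_bit A e = A ^\<^sub>m (if e = 1 then 1 else 0)"

definition pauli_D :: "bit vec \<Rightarrow> bit vec \<Rightarrow> complex mat" where
  "pauli_D a b =
     foldr kron (map (\<lambda>j. mat_pow_bit pauli_X (a $ j) * mat_pow_bit pauli_Z (b $ j)) [0..<dim_vec a])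
       (1\<^sub>m 1)"

definition pauli_set :: "nat \<Rightarrow> complex mat set" where
  "pauli_set n = {\<i> ^ \<kappa> \<cdot>\<^sub>m pauli_D a b | \<kappa> a b. a \<in> carrier_vec n \<and> b \<in> carrier_vec n}"

definition pauli_group :: "nat \<Rightarrow> complex mat monoid" where
  "pauli_group n = \<lparr>carrier = pauli_set n, monoid.mult = (*), one = 1\<^sub>m (2 ^ n)\<rparr>"

text \<open>The map \<open>\<phi>(\<i>\<^sup>\<kappa> D(a,b)) = [a,b]\<close>, unspecified outside the Pauli group. It is well defined
  because distinct operators \<open>D(a,b)\<close> are linearly independent.\<close>

definition pauli_phi :: "nat \<Rightarrow> complex mat \<Rightarrow> bit vec" where
  "pauli_phi n P = (THE v. \<exists>\<kappa> a b. a \<in> carrier_vec n \<and> b \<in> carrier_vec n \<and>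
     P = \<i> ^ \<kappa> \<cdot>\<^sub>m pauli_D a b \<and> v = a @\<^sub>v b)"

definition lin_indep_rows :: "bit mat \<Rightarrow> bool" where
  "lin_indep_rows A \<longleftrightarrow> distinct (rows A) \<and>
     \<not> LinearCombinations.module.lin_dep class_ring (module_vec TYPE(bit) (dim_col A)) (set (rows A))"

definition css_code :: "nat \<Rightarrow> nat \<Rightarrow> nat \<Rightarrow> nat \<Rightarrow> bit mat \<Rightarrow> bit mat \<Rightarrow> bool" where
  "css_code n k mX mZ HX HZ \<longleftrightarrow>
     HX \<in> carrier_mat mX n \<and> HZ \<in> carrier_mat mZ n \<and> k \<le> n \<and> mX + mZ = n - k \<and>
     HX * transpose_mat HZ = 0\<^sub>m mX mZ \<and> lin_indep_rows HX \<and> lin_indep_rows HZ"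

definition check_mat :: "nat \<Rightarrow> bit mat \<Rightarrow> bit mat \<Rightarrow> bit mat" where
  "check_mat n HX HZ = four_block_mat HX (0\<^sub>m (dim_row HX) n) (0\<^sub>m (dim_row HZ) n) HZ"

definition stab_X :: "nat \<Rightarrow> bit mat \<Rightarrow> nat \<Rightarrow> complex mat" where
  "stab_X n HX i = pauli_D (row HX i) (0\<^sub>v n)"

definition stab_Z :: "nat \<Rightarrow> bit mat \<Rightarrow> nat \<Rightarrow> complex mat" where
  "stab_Z n HZ i = pauli_D (0\<^sub>v n) (row HZ i)"

definition stabilizer_group :: "nat \<Rightarrow> bit mat \<Rightarrow> bit mat \<Rightarrow> complex mat set" where
  "stabilizer_group n HX HZ =
     generate (pauli_group n) (stab_X n HX ` {..<dim_row HX} \<union> stab_Z n HZ ` {..<dim_row HZ})"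

definition col_space :: "bit mat \<Rightarrow> bit vec set" where
  "col_space A = (\<lambda>y. A *\<^sub>v y) ` carrier_vec (dim_col A)"

text \<open>The vectors \<open>l 0, \<dots>, l (k - 1)\<close> in \<open>V\<close> represent a basis of the quotient \<open>V / W\<close>: their
  classes are linearly independent and span, where a class is zero iff its representatives lie
  in \<open>W\<close>.\<close>

definition lin_comb :: "nat \<Rightarrow> nat \<Rightarrow> (nat \<Rightarrow> bit vec) \<Rightarrow> bit vec \<Rightarrow> bit vec" where
  "lin_comb n k l c = mat_of_cols n (map l [0..<k]) *\<^sub>v c"

definition represents_quotient_basis ::
    "nat \<Rightarrow> nat \<Rightarrow> bit vec set \<Rightarrow> bit vec set \<Rightarrow> (nat \<Rightarrow> bit vec) \<Rightarrow> bool" where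
  "represents_quotient_basis n k V W l \<longleftrightarrow>
     (\<forall>i<k. l i \<in> V) \<and>
     (\<forall>c \<in> carrier_vec k. lin_comb n k l c \<in> W \<longrightarrow> c = 0\<^sub>v k) \<and>
     (\<forall>v \<in> V. \<exists>c \<in> carrier_vec k. v - lin_comb n k l c \<in> W)"

definition logical_basis ::
    "nat \<Rightarrow> nat \<Rightarrow> bit mat \<Rightarrow> bit mat \<Rightarrow> (nat \<Rightarrow> bit vec) \<Rightarrow> (nat \<Rightarrow> bit vec) \<Rightarrow> bool" where
  "logical_basis n k HX HZ lX lZ \<longleftrightarrow>
     represents_quotient_basis n k (mat_kernel HZ) (col_space (transpose_mat HX)) lX \<and>
     represents_quotient_basis n k (mat_kernel HX) (col_space (transpose_mat HZ)) lZ \<and>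
     (\<forall>i<k. \<forall>j<k. lX i \<bullet> lZ j = (if i = j then 1 else 0))"

definition logical_X :: "nat \<Rightarrow> (nat \<Rightarrow> bit vec) \<Rightarrow> nat \<Rightarrow> complex mat" where
  "logical_X n lX i = pauli_D (lX i) (0\<^sub>v n)"

definition logical_Z :: "nat \<Rightarrow> (nat \<Rightarrow> bit vec) \<Rightarrow> nat \<Rightarrow> complex mat" where
  "logical_Z n lZ i = pauli_D (0\<^sub>v n) (lZ i)"

definition logical_pauli_group ::
    "nat \<Rightarrow> nat \<Rightarrow> (nat \<Rightarrow> bit vec) \<Rightarrow> (nat \<Rightarrow> bit vec) \<Rightarrow> complex mat set" where
  "logical_pauli_group n k lX lZ =
     generate (pauli_group n) (logical_X n lX ` {..<k} \<union> logical_Z n lZ ` {..<k})"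

definition logical_mat ::
    "nat \<Rightarrow> nat \<Rightarrow> (nat \<Rightarrow> bit vec) \<Rightarrow> (nat \<Rightarrow> bit vec) \<Rightarrow> bit mat" where
  "logical_mat n k lX lZ = mat_of_rows (2 * n)
     (map (\<lambda>i. lX i @\<^sub>v 0\<^sub>v n) [0..<k] @ map (\<lambda>i. 0\<^sub>v n @\<^sub>v lZ i) [0..<k])"

definition conj_by :: "complex mat \<Rightarrow> complex mat \<Rightarrow> complex mat" where
  "conj_by g P = g * P * mat_adjoint g"

definition clifford_unitary :: "nat \<Rightarrow> complex mat \<Rightarrow> bool" where
  "clifford_unitary n g \<longleftrightarrow>
     g \<in> carrier_mat (2 ^ n) (2 ^ n) \<and>
     g * mat_adjoint g = 1\<^sub>m (2 ^ n) \<and> mat_adjoint g * g = 1\<^sub>m (2 ^ n) \<and>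
     conj_by g ` pauli_set n = pauli_set n"

text \<open>Normalization is taken modulo the phases \<open>\<i>\<^sup>\<kappa>\<close>. For the logical Pauli group this is
  essential: the group generated by the \<open>X\<^sub>i\<close> and \<open>Z\<^sub>i\<close> contains \<open>\<plusminus>X\<^sub>iZ\<^sub>i\<close> but not the Hermitian
  operator \<open>\<i>X\<^sub>iZ\<^sub>i\<close>, to which the logical phase gate sends \<open>X\<^sub>i\<close>. For unitary \<open>g\<close> exact
  normalization of \<open>G\<close> is a special case.\<close>

definition with_phases :: "complex mat set \<Rightarrow> complex mat set" where
  "with_phases G = {\<i> ^ \<kappa> \<cdot>\<^sub>m P | \<kappa> P. P \<in> G}"

definition normalizes :: "complex mat \<Rightarrow> complex mat set \<Rightarrow> bool" where
  "normalizes g G \<longleftrightarrow> conj_by g ` with_phases G = with_phases G"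

definition clifford_logical_operator ::
    "nat \<Rightarrow> nat \<Rightarrow> bit mat \<Rightarrow> bit mat \<Rightarrow> (nat \<Rightarrow> bit vec) \<Rightarrow> (nat \<Rightarrow> bit vec) \<Rightarrow> complex mat \<Rightarrow> bool"
  where
  "clifford_logical_operator n k HX HZ lX lZ g \<longleftrightarrow>
     clifford_unitary n g \<and>
     normalizes g (stabilizer_group n HX HZ) \<and>
     normalizes g (logical_pauli_group n k lX lZ)"

definition logical_action ::
    "nat \<Rightarrow> nat \<Rightarrow> (nat \<Rightarrow> bit vec) \<Rightarrow> (nat \<Rightarrow> bit vec) \<Rightarrow> complex mat \<Rightarrow> bit mat \<Rightarrow> bool" where
  "logical_action n k lX lZ g M_L \<longleftrightarrow>
     M_L \<in> carrier_mat (2 * k) (2 * k) \<and> invertible_mat M_L \<and>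
     (\<forall>i<k. pauli_phi n (conj_by g (logical_X n lX i)) = row (M_L * logical_mat n k lX lZ) i \<and>
            pauli_phi n (conj_by g (logical_Z n lZ i)) = row (M_L * logical_mat n k lX lZ) (k + i))"

definition stabilizer_action ::
    "nat \<Rightarrow> nat \<Rightarrow> bit mat \<Rightarrow> bit mat \<Rightarrow> complex mat \<Rightarrow> bit mat \<Rightarrow> bool" where
  "stabilizer_action n k HX HZ g M_S \<longleftrightarrow>
     M_S \<in> carrier_mat (n - k) (n - k) \<and> invertible_mat M_S \<and>
     (\<forall>i<dim_row HX.
        pauli_phi n (conj_by g (stab_X n HX i)) = row (M_S * check_mat n HX HZ) i) \<and>
     (\<forall>i<dim_row HZ.
        pauli_phi n (conj_by g (stab_Z n HZ i)) = row (M_S * check_mat n HX HZ) (dim_row HX + i))"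

definition valid_symplectic ::
    "nat \<Rightarrow> nat \<Rightarrow> bit mat \<Rightarrow> bit mat \<Rightarrow> (nat \<Rightarrow> bit vec) \<Rightarrow> (nat \<Rightarrow> bit vec) \<Rightarrow> complex mat \<Rightarrow>
     bit mat \<Rightarrow> bool" where
  "valid_symplectic n k HX HZ lX lZ g F \<longleftrightarrow>
     F \<in> Sp n \<and>
     (\<exists>M_L M_S. logical_action n k lX lZ g M_L \<and> stabilizer_action n k HX HZ g M_S \<and>
        logical_mat n k lX lZ * F = M_L * logical_mat n k lX lZ \<and>
        check_mat n HX HZ * F = M_S * check_mat n HX HZ)"

text \<open>\<open>outer_sum n k u w\<close> is the \<open>n \<times> n\<close> matrix \<open>\<Sum>i<k. (u i)\<^sup>T (w i)\<close>, and \<open>row_part M i s n\<close>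
  is the part of row \<open>i\<close> of \<open>M\<close> in the \<open>n\<close> columns starting at column \<open>s\<close>.\<close>

definition outer_sum :: "nat \<Rightarrow> nat \<Rightarrow> (nat \<Rightarrow> bit vec) \<Rightarrow> (nat \<Rightarrow> bit vec) \<Rightarrow> bit mat" where
  "outer_sum n k u w = mat n n (\<lambda>(r, c). \<Sum>i<k. u i $ r * w i $ c)"

definition row_part :: "bit mat \<Rightarrow> nat \<Rightarrow> nat \<Rightarrow> nat \<Rightarrow> bit vec" where
  "row_part M i s n = vec n (\<lambda>j. M $$ (i, s + j))"

definition logical_symplectic ::
    "nat \<Rightarrow> nat \<Rightarrow> (nat \<Rightarrow> bit vec) \<Rightarrow> (nat \<Rightarrow> bit vec) \<Rightarrow> bit mat \<Rightarrow> bit mat" where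
  "logical_symplectic n k lX lZ M_L =
    (let L' = (M_L + 1\<^sub>m (2 * k)) * logical_mat n k lX lZ;
         A = 1\<^sub>m n + outer_sum n k lZ (\<lambda>i. row_part L' i 0 n);
         B = outer_sum n k lZ (\<lambda>i. row_part L' i n n);
         C = outer_sum n k lX (\<lambda>i. row_part L' (k + i) 0 n);
         D = 1\<^sub>m n + outer_sum n k lX (\<lambda>i. row_part L' (k + i) n n)
     in four_block_mat A B C D)"

end

theory Submission
  imports Defs
begin

text \<open>With \<open>L\<close> the matrix of the logical operators, \<open>W = \<Omega>\<^sub>n\<close> and \<open>V = \<Omega>\<^sub>k\<close>, the hypotheses
  on the code say that \<open>L W L\<^sup>T = V\<close> and \<open>H W L\<^sup>T = 0\<close>, and the block matrix of the theorem is
  \<open>F = I + W L\<^sup>T V (M + I) L\<close>. Hence \<open>L F = L + (M + I) L = M L\<close> and \<open>H F = H\<close>. With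
  \<open>T = V (M + I)\<close> one finds \<open>F W F\<^sup>T = W + W L\<^sup>T (T + T\<^sup>T + T V T\<^sup>T) L W\<close>, where the bracket
  vanishes in characteristic 2 as soon as \<open>M\<close> is symplectic. That in turn holds because conjugation
  by \<open>g\<close> preserves the commutation signs of Pauli operators, and these are given by the symplectic
  form of their images under \<open>\<phi>\<close>.\<close>

text \<open>These two rules would rewrite bit arithmetic to Boolean conditions.\<close>

declare add_bit_eq_xor [simp del] mult_bit_eq_and [simp del]

section \<open>Bit arithmetic and the symplectic form\<close>

lemma bit_add_self [simp]: "(e :: bit) + e = 0"
  by (cases e) simp_all

lemma symp_form_carrier [simp]: "symp_form n \<in> carrier_mat (2 * n) (2 * n)"
  unfolding symp_form_def by (metis four_block_carrier_mat mult_2 one_carrier_mat zero_carrier_mat)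

lemma transpose_symp_form: "transpose_mat (symp_form n) = symp_form n"
  unfolding symp_form_def by (subst transpose_four_block_mat) auto

lemma symp_form_square: "symp_form n * symp_form n = 1\<^sub>m (2 * n)"
proof -
  have "symp_form n * symp_form n = four_block_mat (1\<^sub>m n) (0\<^sub>m n n) (0\<^sub>m n n) (1\<^sub>m n)"
    unfolding symp_form_def by (subst mult_four_block_mat[of _ n n _ n _ n _ _ n _ n]) auto
  then show ?thesis
    by (simp add: four_block_one_mat mult_2)
qed

section \<open>Kronecker products\<close>

lemma kron_carrier [simp]:
  "A \<in> carrier_mat m n \<Longrightarrow> B \<in> carrier_mat p q \<Longrightarrow> kron A B \<in> carrier_mat (m * p) (n * q)"
  by (simp add: kron_def)

lemma kron_smult_left: "kron (c \<cdot>\<^sub>m A) B = c \<cdot>\<^sub>m kron A B"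
proof (rule eq_matI)
  fix i j assume "i < dim_row (c \<cdot>\<^sub>m kron A B)" "j < dim_col (c \<cdot>\<^sub>m kron A B)"
  then show "kron (c \<cdot>\<^sub>m A) B $$ (i, j) = (c \<cdot>\<^sub>m kron A B) $$ (i, j)"
    by (simp add: kron_def less_mult_imp_div_less)
qed (auto simp: kron_def)

lemma kron_smult_right: "kron A (c \<cdot>\<^sub>m B) = c \<cdot>\<^sub>m kron A B"
proof (rule eq_matI)
  fix i j assume ij: "i < dim_row (c \<cdot>\<^sub>m kron A B)" "j < dim_col (c \<cdot>\<^sub>m kron A B)"
  \<comment> \<open>A remainder modulo a dimension of \<open>B\<close> is a valid index only if that
    dimension is positive; the existence of the index \<open>(i, j)\<close> guarantees this.\<close>
  then have "0 < dim_row B" "0 < dim_col B"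
    by (auto simp: kron_def intro!: Nat.gr0I)
  with ij show "kron A (c \<cdot>\<^sub>m B) $$ (i, j) = (c \<cdot>\<^sub>m kron A B) $$ (i, j)"
    by (simp add: kron_def)
qed (auto simp: kron_def)

text \<open>Quotient and remainder give a bijection between indices below \<open>m * n\<close> and
  pairs of indices. It turns the inner summation index of a product of Kronecker products into a
  double sum.\<close>

lemma sum_div_mod:
  fixes f :: "nat \<Rightarrow> nat \<Rightarrow> 'a::comm_monoid_add"
  shows "(\<Sum>t<m * n. f (t div n) (t mod n)) = (\<Sum>i<m. \<Sum>j<n. f i j)"
proof -
  have "(\<Sum>(i, j)\<in>{..<m} \<times> {..<n}. f i j) = (\<Sum>t<m * n. f (t div n) (t mod n))"
  proof (rule sum.reindex_bij_witness[where i = "\<lambda>t. (t div n, t mod n)" and j = "\<lambda>(i, j). i * n + j"])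
    fix a assume "a \<in> {..<m} \<times> {..<n}"
    then obtain i j where a: "a = (i, j)" "i < m" "j < n" by auto
    then have "i * n + j < Suc i * n" by simp
    also have "\<dots> \<le> m * n" using a by (intro mult_le_mono1) simp
    finally show "(case a of (i, j) \<Rightarrow> i * n + j) \<in> {..<m * n}" using a by simp
  next
    fix b assume "b \<in> {..<m * n}"
    then show "(b div n, b mod n) \<in> {..<m} \<times> {..<n}"
      by (auto simp: less_mult_imp_div_less) (metis mod_less_divisor mult_0_right not_gr_zero not_less_zero)
  qed auto
  then show ?thesis by (simp add: sum.cartesian_product)
qed

text \<open>The mixed-product rule: after \<open>sum_div_mod\<close> the summand separates into a
  factor depending on \<open>u\<close> and one depending on \<open>v\<close>, so the double sum is a
  product of two matrix entries.\<close>

lemma kron_mult: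
  assumes "A \<in> carrier_mat m n" "B \<in> carrier_mat n p" "C \<in> carrier_mat q r" "D \<in> carrier_mat r s"
  shows "kron A C * kron B D = kron (A * B) (C * D)"
proof (rule eq_matI)
  fix i j assume "i < dim_row (kron (A * B) (C * D))" "j < dim_col (kron (A * B) (C * D))"
  then have ij: "i < m * q" "j < p * s" using assms by (auto simp: kron_def)
  then have pos: "0 < q" "0 < s" by (auto intro!: Nat.gr0I)
  have b: "i div q < m" "j div s < p" "i mod q < q" "j mod s < s"
    using ij pos by (auto simp: less_mult_imp_div_less)
  have "(kron A C * kron B D) $$ (i, j) =
      (\<Sum>t<n * r. (A $$ (i div q, t div r) * C $$ (i mod q, t mod r)) *
        (B $$ (t div r, j div s) * D $$ (t mod r, j mod s)))"
    using assms ij by (simp add: kron_def scalar_prod_def atLeast0LessThan)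
  also have "\<dots> = (\<Sum>u<n. \<Sum>v<r. (A $$ (i div q, u) * C $$ (i mod q, v)) *
        (B $$ (u, j div s) * D $$ (v, j mod s)))"
    by (rule sum_div_mod)
  also have "\<dots> = (\<Sum>u<n. A $$ (i div q, u) * B $$ (u, j div s)) *
      (\<Sum>v<r. C $$ (i mod q, v) * D $$ (v, j mod s))"
    by (simp add: sum_product mult_ac)
  also have "\<dots> = kron (A * B) (C * D) $$ (i, j)"
    using assms ij b by (simp add: kron_def scalar_prod_def atLeast0LessThan)
  finally show "(kron A C * kron B D) $$ (i, j) = kron (A * B) (C * D) $$ (i, j)" .
qed (use assms in \<open>auto simp: kron_def\<close>)

lemma kron_one: "kron (1\<^sub>m m) (1\<^sub>m n) = 1\<^sub>m (m * n)"
proof (rule eq_matI)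
  fix i j assume "i < dim_row (1\<^sub>m (m * n) :: complex mat)" "j < dim_col (1\<^sub>m (m * n) :: complex mat)"
  then have ij: "i < m * n" "j < m * n" by auto
  then have "0 < n" by (auto intro!: Nat.gr0I)
  then have "i mod n < n" "j mod n < n" by auto
  moreover have "i = j \<longleftrightarrow> i div n = j div n \<and> i mod n = j mod n"
    by (metis div_mult_mod_eq)
  ultimately show "kron (1\<^sub>m m) (1\<^sub>m n) $$ (i, j) = 1\<^sub>m (m * n) $$ (i, j)"
    using ij by (auto simp: kron_def less_mult_imp_div_less)
qed (auto simp: kron_def)

section \<open>Signs and Pauli operators as Kronecker products\<close>

text \<open>The nontrivial character of the additive group of \<open>bit\<close>. Its injectivity
  turns equal commutation signs back into equal symplectic products.\<close>

definition bit_sign :: "bit \<Rightarrow> complex" where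
  "bit_sign e = (if e = 1 then -1 else 1)"

lemma bit_sign_0 [simp]: "bit_sign 0 = 1"
  by (simp add: bit_sign_def)

lemma bit_sign_add: "bit_sign (e + f) = bit_sign e * bit_sign f"
  by (cases e; cases f) (simp_all add: bit_sign_def)

lemma bit_sign_neq_0 [simp]: "bit_sign e \<noteq> 0"
  by (simp add: bit_sign_def)

lemma bit_sign_inject [simp]: "bit_sign e = bit_sign f \<longleftrightarrow> e = f"
  by (cases e; cases f) (simp_all add: bit_sign_def)

definition pauli_factor :: "bit \<Rightarrow> bit \<Rightarrow> complex mat" where
  "pauli_factor a b = mat_pow_bit pauli_X a * mat_pow_bit pauli_Z b"

lemma pauli_factor_eq:
  "pauli_factor a b = mat 2 2 (\<lambda>(i, j). if (i = j) = (a = 0) then (if j = 1 then bit_sign b else 1) else 0)"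
proof -
  have X: "pauli_X \<in> carrier_mat 2 2" and Z: "pauli_Z \<in> carrier_mat 2 2"
    by (auto simp: pauli_X_def pauli_Z_def mat_of_rows_list_def)
  show ?thesis
    using X Z
    by (intro eq_matI; cases a; cases b)
      (auto simp: pauli_factor_def mat_pow_bit_def scalar_prod_def bit_sign_def
        numeral_2_eq_2 less_Suc_eq pauli_X_def pauli_Z_def mat_of_rows_list_def)
qed

lemma pauli_factor_carrier [simp]: "pauli_factor a b \<in> carrier_mat 2 2"
  by (simp add: pauli_factor_eq)

text \<open>Moving \<open>Z\<close> past \<open>X\<close> costs a factor -1, so the sign depends
  only on the inner exponents \<open>b\<close> and \<open>c\<close>; the exponents add modulo 2
  because both matrices square to the identity.\<close>

lemma pauli_factor_mult:
  "pauli_factor a b * pauli_factor c d = bit_sign (b * c) \<cdot>\<^sub>m pauli_factor (a + c) (b + d)"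
  by (intro eq_matI; cases a; cases b; cases c; cases d)
    (auto simp: pauli_factor_eq scalar_prod_def bit_sign_def numeral_2_eq_2 less_Suc_eq)

lemma one_smult_mat: "(1 :: 'a::monoid_mult) \<cdot>\<^sub>m A = A"
  by (intro eq_matI) auto

lemma smult_smult_mat: "(s :: 'a::semigroup_mult) \<cdot>\<^sub>m (t \<cdot>\<^sub>m A) = (s * t) \<cdot>\<^sub>m A"
  by (intro eq_matI) (auto simp: mult.assoc)

lemma foldr_kron_carrier:
  "foldr kron (map (\<lambda>j. pauli_factor (a j) (b j)) js) (1\<^sub>m 1)
     \<in> carrier_mat (2 ^ length js) (2 ^ length js)"
  by (induction js) auto

text \<open>The exponents are functions of the position and the list of positions is arbitrary, so
  that the induction can peel off one qubit at a time; \<open>kron_mult\<close> separates that qubit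
  and its sign joins the others.\<close>

lemma foldr_kron_mult:
  "foldr kron (map (\<lambda>j. pauli_factor (a j) (b j)) js) (1\<^sub>m 1) *
   foldr kron (map (\<lambda>j. pauli_factor (c j) (d j)) js) (1\<^sub>m 1) =
   bit_sign (\<Sum>j\<leftarrow>js. b j * c j) \<cdot>\<^sub>m
   foldr kron (map (\<lambda>j. pauli_factor (a j + c j) (b j + d j)) js) (1\<^sub>m 1)"
proof (induction js)
  case Nil
  then show ?case by (intro eq_matI) auto
next
  case (Cons i js)
  show ?case
    by (simp add: kron_mult[OF pauli_factor_carrier pauli_factor_carrier foldr_kron_carrier foldr_kron_carrier]
        Cons.IH pauli_factor_mult kron_smult_left kron_smult_right bit_sign_add smult_smult_mat mult.commute del: One_nat_def)
qed

lemma pauli_D_altdef: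
  "a \<in> carrier_vec n \<Longrightarrow>
   pauli_D a b = foldr kron (map (\<lambda>j. pauli_factor (a $ j) (b $ j)) [0..<n]) (1\<^sub>m 1)"
  by (simp add: pauli_D_def pauli_factor_def)

lemma pauli_D_carrier [simp]: "a \<in> carrier_vec n \<Longrightarrow> pauli_D a b \<in> carrier_mat (2 ^ n) (2 ^ n)"
  using foldr_kron_carrier[of "($) a" "($) b" "[0..<n]"] by (simp add: pauli_D_altdef)

lemma pauli_D_mult:
  assumes "a \<in> carrier_vec n" "b \<in> carrier_vec n" "c \<in> carrier_vec n" "d \<in> carrier_vec n"
  shows "pauli_D a b * pauli_D c d = bit_sign (b \<bullet> c) \<cdot>\<^sub>m pauli_D (a + c) (b + d)"
proof -
  have eq: "map (\<lambda>j. pauli_factor (a $ j + c $ j) (b $ j + d $ j)) [0..<n] =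
      map (\<lambda>j. pauli_factor ((a + c) $ j) ((b + d) $ j)) [0..<n]"
    using assms by auto
  have sum: "(\<Sum>j\<leftarrow>[0..<n]. b $ j * c $ j) = b \<bullet> c"
    using assms by (simp add: scalar_prod_def sum_list_distinct_conv_sum_set)
  have ac: "a + c \<in> carrier_vec n"
    using assms by simp
  show ?thesis
    unfolding pauli_D_altdef[OF assms(1)] pauli_D_altdef[OF assms(3)] pauli_D_altdef[OF ac]
      foldr_kron_mult eq sum ..
qed

lemma pauli_D_zero: "pauli_D (0\<^sub>v n) (0\<^sub>v n) = 1\<^sub>m (2 ^ n)"
proof -
  have one: "pauli_factor 0 0 = 1\<^sub>m 2"
    by (intro eq_matI) (auto simp: pauli_factor_eq)
  have "foldr kron (map (\<lambda>j. pauli_factor 0 0) js) (1\<^sub>m 1) = 1\<^sub>m (2 ^ length js)" for js :: "nat list"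
    by (induction js) (simp_all add: one kron_one)
  moreover have "map (\<lambda>j. pauli_factor (0\<^sub>v n $ j) (0\<^sub>v n $ j)) [0..<n] = map (\<lambda>j. pauli_factor 0 0) [0..<n]"
    by auto
  ultimately show ?thesis
    by (simp add: pauli_D_altdef[of _ n] del: map_eq_conv)
qed

lemma pauli_D_square:
  assumes "a \<in> carrier_vec n" "b \<in> carrier_vec n"
  shows "pauli_D a b * pauli_D a b = bit_sign (b \<bullet> a) \<cdot>\<^sub>m 1\<^sub>m (2 ^ n)"
proof -
  have "v + v = 0\<^sub>v n" if "v \<in> carrier_vec n" for v :: "bit vec"
    using that by (intro eq_vecI) auto
  with assms show ?thesis by (simp add: pauli_D_mult pauli_D_zero)
qed

text \<open>By \<open>pauli_D_mult\<close> both orders are multiples of the same operator, with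
  signs given by \<open>b \<bullet> c\<close> and \<open>d \<bullet> a\<close>; since signs square
  to 1, their quotient is their product.\<close>

lemma pauli_D_commute:
  assumes "a \<in> carrier_vec n" "b \<in> carrier_vec n" "c \<in> carrier_vec n" "d \<in> carrier_vec n"
  shows "pauli_D a b * pauli_D c d = bit_sign (a \<bullet> d + b \<bullet> c) \<cdot>\<^sub>m (pauli_D c d * pauli_D a b)"
proof -
  have "a + c = c + a" "b + d = d + b" "d \<bullet> a = a \<bullet> d"
    using assms by (auto simp: comm_add_vec comm_scalar_prod)
  moreover have "bit_sign (e + f) * bit_sign e = bit_sign f" for e f
    by (simp add: bit_sign_add bit_sign_def)
  ultimately show ?thesis
    using assms by (simp add: pauli_D_mult[of _ n] smult_smult_mat)
qed

section \<open>Commutation signs and the map \<open>pauli_phi\<close>\<close>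

lemma pauli_setE:
  assumes "P \<in> pauli_set n"
  obtains \<kappa> a b where "a \<in> carrier_vec n" "b \<in> carrier_vec n" "P = \<i> ^ \<kappa> \<cdot>\<^sub>m pauli_D a b"
  using assms by (auto simp: pauli_set_def)

lemma pauli_set_carrier: "P \<in> pauli_set n \<Longrightarrow> P \<in> carrier_mat (2 ^ n) (2 ^ n)"
  by (elim pauli_setE) auto

lemma pauli_D_in_pauli_set:
  "a \<in> carrier_vec n \<Longrightarrow> b \<in> carrier_vec n \<Longrightarrow> pauli_D a b \<in> pauli_set n"
  unfolding pauli_set_def by (force simp: one_smult_mat intro: exI[of _ 0])

lemma smult_mult_smult_mat:
  fixes A B :: "'a::comm_semiring_1 mat"
  assumes "A \<in> carrier_mat m n" "B \<in> carrier_mat n p"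
  shows "(s \<cdot>\<^sub>m A) * (t \<cdot>\<^sub>m B) = (s * t) \<cdot>\<^sub>m (A * B)"
  using assms by (simp add: mult_smult_distrib[of _ m n _ p] mult_smult_assoc_mat[of _ m n _ p] smult_smult_mat mult.commute)

text \<open>A nonzero scalar square makes Pauli operators invertible, which is what the nonvanishing
  of their products rests on.\<close>

lemma pauli_set_square:
  assumes "P \<in> pauli_set n"
  obtains s where "s \<noteq> 0" "P * P = s \<cdot>\<^sub>m 1\<^sub>m (2 ^ n)"
proof -
  obtain \<kappa> a b where P: "a \<in> carrier_vec n" "b \<in> carrier_vec n" "P = \<i> ^ \<kappa> \<cdot>\<^sub>m pauli_D a b"
    using assms by (rule pauli_setE)
  then have "P * P = (\<i> ^ \<kappa> * \<i> ^ \<kappa> * bit_sign (b \<bullet> a)) \<cdot>\<^sub>m 1\<^sub>m (2 ^ n)"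
    by (simp add: smult_mult_smult_mat[of _ "2 ^ n" "2 ^ n" _ "2 ^ n"] pauli_D_square smult_smult_mat)
  then show thesis by (intro that) auto
qed

lemma pauli_set_mult_neq_0:
  assumes P: "P \<in> pauli_set n" and Q: "Q \<in> pauli_set n"
  shows "P * Q \<noteq> 0\<^sub>m (2 ^ n) (2 ^ n)"
proof
  assume 0: "P * Q = 0\<^sub>m (2 ^ n) (2 ^ n)"
  obtain s t where s: "s \<noteq> 0" "P * P = s \<cdot>\<^sub>m 1\<^sub>m (2 ^ n)" and t: "t \<noteq> 0" "Q * Q = t \<cdot>\<^sub>m 1\<^sub>m (2 ^ n)"
    using pauli_set_square[OF P] pauli_set_square[OF Q] by metis
  note c = pauli_set_carrier[OF P] pauli_set_carrier[OF Q]
  have "P * (P * Q) * Q = P * P * (Q * Q)"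
    using c by (simp add: assoc_mult_mat[of _ "2 ^ n" "2 ^ n" _ "2 ^ n" _ "2 ^ n"])
  also have "\<dots> = (s * t) \<cdot>\<^sub>m 1\<^sub>m (2 ^ n)"
    by (simp add: s t smult_mult_smult_mat[of _ "2 ^ n" "2 ^ n" _ "2 ^ n"])
  finally have "(s * t) \<cdot>\<^sub>m 1\<^sub>m (2 ^ n) = 0\<^sub>m (2 ^ n) (2 ^ n)"
    using c by (simp add: 0)
  \<comment> \<open>The entry at position (0, 0) exists for every \<open>n\<close>, including 0, as
    the dimension \<open>2 ^ n\<close> is positive.\<close>
  then have "((s * t) \<cdot>\<^sub>m 1\<^sub>m (2 ^ n)) $$ (0, 0) = (0\<^sub>m (2 ^ n) (2 ^ n) :: complex mat) $$ (0, 0)"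
    by simp
  with s t show False by simp
qed

text \<open>If \<open>s\<close> and \<open>t\<close> differed, every entry of \<open>Q * P\<close>
  would vanish, but a product of Pauli operators is nonzero.\<close>

lemma commutation_sign_unique:
  assumes P: "P \<in> pauli_set n" and Q: "Q \<in> pauli_set n"
    and "P * Q = s \<cdot>\<^sub>m (Q * P)" "P * Q = t \<cdot>\<^sub>m (Q * P)"
  shows "s = t"
proof (rule ccontr)
  assume "s \<noteq> t"
  note c = pauli_set_carrier[OF P] pauli_set_carrier[OF Q]
  have eq: "s \<cdot>\<^sub>m (Q * P) = t \<cdot>\<^sub>m (Q * P)" using assms by simp
  have "Q * P = 0\<^sub>m (2 ^ n) (2 ^ n)"
  proof (rule eq_matI)
    fix i j assume ij: "i < dim_row (0\<^sub>m (2 ^ n) (2 ^ n) :: complex mat)" "j < dim_col (0\<^sub>m (2 ^ n) (2 ^ n) :: complex mat)"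
    then have "(s \<cdot>\<^sub>m (Q * P)) $$ (i, j) = s * (Q * P) $$ (i, j)"
      "(t \<cdot>\<^sub>m (Q * P)) $$ (i, j) = t * (Q * P) $$ (i, j)"
      using c by (auto simp del: index_mult_mat(1))
    with eq \<open>s \<noteq> t\<close> have "(Q * P) $$ (i, j) = 0" by simp
    then show "(Q * P) $$ (i, j) = 0\<^sub>m (2 ^ n) (2 ^ n) $$ (i, j)" using ij by simp
  qed (use c in auto)
  with pauli_set_mult_neq_0[OF Q P] show False by simp
qed

lemma pauli_phase_commute:
  assumes "a \<in> carrier_vec n" "b \<in> carrier_vec n" "c \<in> carrier_vec n" "d \<in> carrier_vec n"
  shows "(s \<cdot>\<^sub>m pauli_D a b) * (t \<cdot>\<^sub>m pauli_D c d) =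
    bit_sign (a \<bullet> d + b \<bullet> c) \<cdot>\<^sub>m ((t \<cdot>\<^sub>m pauli_D c d) * (s \<cdot>\<^sub>m pauli_D a b))"
proof -
  have "(s \<cdot>\<^sub>m pauli_D a b) * (t \<cdot>\<^sub>m pauli_D c d) = (s * t) \<cdot>\<^sub>m (pauli_D a b * pauli_D c d)"
    using assms by (simp add: smult_mult_smult_mat[of _ "2 ^ n" "2 ^ n" _ "2 ^ n"])
  also have "\<dots> = (s * t) \<cdot>\<^sub>m (bit_sign (a \<bullet> d + b \<bullet> c) \<cdot>\<^sub>m (pauli_D c d * pauli_D a b))"
    using assms by (simp add: pauli_D_commute[of a n b c d])
  also have "\<dots> = bit_sign (a \<bullet> d + b \<bullet> c) \<cdot>\<^sub>m ((t * s) \<cdot>\<^sub>m (pauli_D c d * pauli_D a b))"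
    by (simp add: smult_smult_mat mult_ac)
  also have "(t * s) \<cdot>\<^sub>m (pauli_D c d * pauli_D a b) = (t \<cdot>\<^sub>m pauli_D c d) * (s \<cdot>\<^sub>m pauli_D a b)"
    using assms by (simp add: smult_mult_smult_mat[of _ "2 ^ n" "2 ^ n" _ "2 ^ n"])
  finally show ?thesis .
qed

text \<open>A Pauli operator is determined up to phase by its commutation signs with all \<open>D(c,d)\<close>,
  because the symplectic form is nondegenerate.\<close>

lemma pauli_D_unique:
  assumes ab: "a \<in> carrier_vec n" "b \<in> carrier_vec n" and ab': "a' \<in> carrier_vec n" "b' \<in> carrier_vec n"
    and eq: "\<i> ^ \<kappa> \<cdot>\<^sub>m pauli_D a b = \<i> ^ \<kappa>' \<cdot>\<^sub>m pauli_D a' b'"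
  shows "a = a'" "b = b'"
proof -
  have signs: "a \<bullet> d + b \<bullet> c = a' \<bullet> d + b' \<bullet> c"
    if cd: "c \<in> carrier_vec n" "d \<in> carrier_vec n" for c d
  proof -
    \<comment> \<open>The trivial phase \<open>\<i> ^ 0\<close> brings the test operator into the
      scaled form that \<open>pauli_phase_commute\<close> expects.\<close>
    have P: "\<i> ^ \<kappa> \<cdot>\<^sub>m pauli_D a b \<in> pauli_set n" and Q: "\<i> ^ 0 \<cdot>\<^sub>m pauli_D c d \<in> pauli_set n"
      unfolding pauli_set_def using ab cd by blast+
    have "bit_sign (a \<bullet> d + b \<bullet> c) = bit_sign (a' \<bullet> d + b' \<bullet> c)"
      by (rule commutation_sign_unique[OF P Q pauli_phase_commute[OF ab cd]])
        (unfold eq, rule pauli_phase_commute[OF ab' cd])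
    then show ?thesis by simp
  qed
  \<comment> \<open>Testing against \<open>Z\<close> on qubit \<open>i\<close> alone reads off
    \<open>a $ i\<close>; below, testing against \<open>X\<close> on that qubit reads off
    \<open>b $ i\<close>.\<close>
  show "a = a'"
  proof (rule eq_vecI)
    fix i assume "i < dim_vec a'"
    then show "a $ i = a' $ i"
      using ab ab' signs[of "0\<^sub>v n" "unit_vec n i"] by simp
  qed (use ab ab' in auto)
  show "b = b'"
  proof (rule eq_vecI)
    fix i assume "i < dim_vec b'"
    then show "b $ i = b' $ i"
      using ab ab' signs[of "unit_vec n i" "0\<^sub>v n"] by simp
  qed (use ab ab' in auto)
qed

text \<open>Discharges the definite description in \<open>pauli_phi\<close>: existence is immediate,
  uniqueness is \<open>pauli_D_unique\<close>.\<close>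

lemma pauli_phi_eq:
  assumes "a \<in> carrier_vec n" "b \<in> carrier_vec n"
  shows "pauli_phi n (\<i> ^ \<kappa> \<cdot>\<^sub>m pauli_D a b) = a @\<^sub>v b"
  unfolding pauli_phi_def
proof (rule the_equality)
  fix v
  assume "\<exists>\<kappa>' a' b'. a' \<in> carrier_vec n \<and> b' \<in> carrier_vec n \<and>
    \<i> ^ \<kappa> \<cdot>\<^sub>m pauli_D a b = \<i> ^ \<kappa>' \<cdot>\<^sub>m pauli_D a' b' \<and> v = a' @\<^sub>v b'"
  then show "v = a @\<^sub>v b"
    using pauli_D_unique assms by metis
qed (use assms in blast)

lemma pauli_phi_pauli_D:
  "a \<in> carrier_vec n \<Longrightarrow> b \<in> carrier_vec n \<Longrightarrow> pauli_phi n (pauli_D a b) = a @\<^sub>v b"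
  using pauli_phi_eq[of a n b 0] by (simp add: one_smult_mat)

lemma symp_form_mult_append:
  assumes "a \<in> carrier_vec n" "b \<in> carrier_vec n"
  shows "symp_form n *\<^sub>v (a @\<^sub>v b) = b @\<^sub>v a"
  unfolding symp_form_def using assms
  by (subst four_block_mat_mult_vec[of _ n n _ n _ n]) auto

text \<open>The link between operators and binary vectors: phases cancel in the commutation
  relation, and \<open>symp_form n\<close> swaps the two halves of a vector, which yields
  \<open>a \<bullet> d + b \<bullet> c\<close>.\<close>

lemma pauli_set_commute:
  assumes "P \<in> pauli_set n" "Q \<in> pauli_set n"
  shows "P * Q = bit_sign (pauli_phi n P \<bullet> (symp_form n *\<^sub>v pauli_phi n Q)) \<cdot>\<^sub>m (Q * P)"
proof -
  obtain \<kappa> a b where P: "a \<in> carrier_vec n" "b \<in> carrier_vec n" "P = \<i> ^ \<kappa> \<cdot>\<^sub>m pauli_D a b"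
    using assms(1) by (rule pauli_setE)
  obtain \<kappa>' c d where Q: "c \<in> carrier_vec n" "d \<in> carrier_vec n" "Q = \<i> ^ \<kappa>' \<cdot>\<^sub>m pauli_D c d"
    using assms(2) by (rule pauli_setE)
  have "pauli_phi n P \<bullet> (symp_form n *\<^sub>v pauli_phi n Q) = a \<bullet> d + b \<bullet> c"
    using P Q by (simp add: pauli_phi_eq symp_form_mult_append scalar_prod_append[of _ n _ n])
  then show ?thesis
    using pauli_phase_commute[OF P(1,2) Q(1,2)] P(3) Q(3) by metis
qed

section \<open>Conjugation by a Clifford unitary\<close>

lemma mat_adjoint_carrier: "A \<in> carrier_mat m n \<Longrightarrow> mat_adjoint A \<in> carrier_mat n m"
  by (auto simp: mat_adjoint_def)

lemma conj_by_mult: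
  assumes "clifford_unitary n g" and "P \<in> carrier_mat (2 ^ n) (2 ^ n)" "Q \<in> carrier_mat (2 ^ n) (2 ^ n)"
  shows "conj_by g P * conj_by g Q = conj_by g (P * Q)"
proof -
  define h where "h = mat_adjoint g"
  have g: "g \<in> carrier_mat (2 ^ n) (2 ^ n)" and hg: "h * g = 1\<^sub>m (2 ^ n)"
    using assms by (auto simp: clifford_unitary_def h_def)
  have h: "h \<in> carrier_mat (2 ^ n) (2 ^ n)" using g by (simp add: h_def mat_adjoint_carrier)
  note a = assoc_mult_mat[of _ "2 ^ n" "2 ^ n" _ "2 ^ n" _ "2 ^ n"]
  \<comment> \<open>The inner factor \<open>h * g\<close> is the identity by unitarity.\<close>
  have "g * P * h * (g * Q * h) = g * P * (h * g) * (Q * h)"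
    using g h assms by (simp add: a)
  also have "\<dots> = g * (P * Q) * h"
    using g h assms by (simp add: hg a)
  finally show ?thesis by (simp add: conj_by_def h_def)
qed

lemma conj_by_smult:
  assumes "g \<in> carrier_mat m m" "P \<in> carrier_mat m m"
  shows "conj_by g (s \<cdot>\<^sub>m P) = s \<cdot>\<^sub>m conj_by g P"
  using assms mat_adjoint_carrier[OF assms(1)]
  by (simp add: conj_by_def mult_smult_distrib[of _ m m _ m] mult_smult_assoc_mat[of _ m m _ m])

text \<open>Conjugation is multiplicative and linear, so the conjugated pair obeys the commutation
  relation of the original pair with the same sign. Both are Pauli operators again, hence that sign
  is also the one read off from their images, and uniqueness of signs finishes.\<close>

lemma pauli_phi_conj_by:
  assumes g: "clifford_unitary n g" and P: "P \<in> pauli_set n" and Q: "Q \<in> pauli_set n"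
  shows "pauli_phi n (conj_by g P) \<bullet> (symp_form n *\<^sub>v pauli_phi n (conj_by g Q)) =
    pauli_phi n P \<bullet> (symp_form n *\<^sub>v pauli_phi n Q)"
proof -
  let ?s = "bit_sign (pauli_phi n P \<bullet> (symp_form n *\<^sub>v pauli_phi n Q))"
  note c = pauli_set_carrier[OF P] pauli_set_carrier[OF Q]
  have P': "conj_by g P \<in> pauli_set n" and Q': "conj_by g Q \<in> pauli_set n"
    using g P Q by (auto simp: clifford_unitary_def)
  have "conj_by g P * conj_by g Q = conj_by g (?s \<cdot>\<^sub>m (Q * P))"
    using g c pauli_set_commute[OF P Q] by (simp add: conj_by_mult)
  also have "\<dots> = ?s \<cdot>\<^sub>m (conj_by g Q * conj_by g P)"
    using g c by (subst conj_by_smult[of _ "2 ^ n"]) (auto simp: conj_by_mult clifford_unitary_def)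
  finally have "?s = bit_sign (pauli_phi n (conj_by g P) \<bullet> (symp_form n *\<^sub>v pauli_phi n (conj_by g Q)))"
    using commutation_sign_unique[OF P' Q'] pauli_set_commute[OF P' Q'] by blast
  then show ?thesis by simp
qed

section \<open>Extending a symplectic action on the rows of \<open>L\<close> to the whole
  space\<close>

lemma mult_symp_form_mult_transpose_index:
  fixes R :: "bit mat"
  assumes "R \<in> carrier_mat m (2 * n)" "i < m" "j < m"
  shows "(R * symp_form n * transpose_mat R) $$ (i, j) = row R i \<bullet> (symp_form n *\<^sub>v row R j)"
proof -
  have "(R * symp_form n * transpose_mat R) $$ (i, j) = (R * (symp_form n * transpose_mat R)) $$ (i, j)"
    using assms by (subst assoc_mult_mat[of _ m "2 * n" _ "2 * n" _ m]) auto
  also have "\<dots> = row R i \<bullet> (symp_form n *\<^sub>v row R j)"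
    using assms symp_form_carrier[of n] by (subst index_mult_mat) (auto simp: mult_mat_vec_def intro!: arg_cong2[of _ _ _ _ scalar_prod])
  finally show ?thesis .
qed

text \<open>Pure linear algebra, free of codes and operators: \<open>L\<close> is any matrix whose
  rows have the standard symplectic Gram matrix, and \<open>H\<close> any matrix whose rows are
  symplectically orthogonal to those of \<open>L\<close>.\<close>

lemma symplectic_extension:
  fixes L M H F :: "bit mat"
  assumes L: "L \<in> carrier_mat (2 * k) (2 * n)" and LL: "L * symp_form n * transpose_mat L = symp_form k"
    and M: "M \<in> carrier_mat (2 * k) (2 * k)" and MM: "M * symp_form k * transpose_mat M = symp_form k"
    and F_def: "F = 1\<^sub>m (2 * n) + symp_form n * transpose_mat L * symp_form k * ((M + 1\<^sub>m (2 * k)) * L)"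
  shows "F \<in> Sp n" "L * F = M * L"
    "H \<in> carrier_mat m (2 * n) \<Longrightarrow> H * (symp_form n * transpose_mat L) = 0\<^sub>m m (2 * k) \<Longrightarrow> H * F = H"
proof -
  define W where "W = symp_form n"
  define V where "V = symp_form k"
  define T where "T = V * (M + 1\<^sub>m (2 * k))"
  define J where "J = W * transpose_mat L"
  define R where "R = L * W"
  let ?N = "2 * n" and ?K = "2 * k"
  have W: "W \<in> carrier_mat ?N ?N" "transpose_mat W = W" "W * W = 1\<^sub>m ?N"
    by (simp_all add: W_def transpose_symp_form symp_form_square)
  have V: "V \<in> carrier_mat ?K ?K" "transpose_mat V = V" "V * V = 1\<^sub>m ?K"
    by (simp_all add: V_def transpose_symp_form symp_form_square)
  have T: "T \<in> carrier_mat ?K ?K" using V M by (simp add: T_def)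
  have J: "J \<in> carrier_mat ?N ?K" using W L by (simp add: J_def)
  have R: "R \<in> carrier_mat ?K ?N" using W L by (simp add: R_def)
  note KKK = assoc_mult_mat[of _ ?K ?K _ ?K _ ?K]
  have "(M + 1\<^sub>m ?K) * L \<in> carrier_mat ?K ?N"
    by (rule mult_carrier_mat[of _ _ ?K]) (use M L in auto)
  \<comment> \<open>With this grouping, multiplying by \<open>L\<close> or \<open>H\<close> on the
    left only requires \<open>L * J = V\<close> and \<open>H * J = 0\<close>.\<close>
  then have F: "F = 1\<^sub>m ?N + J * (T * L)"
    using J V M L unfolding F_def W_def[symmetric] V_def[symmetric] J_def[symmetric] T_def
    by (simp add: assoc_mult_mat[of _ ?N ?K _ ?K _ ?N] assoc_mult_mat[of _ ?K ?K _ ?K _ ?N])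
  then have Fc: "F \<in> carrier_mat ?N ?N" using J T L by simp
  have LJ: "L * J = V"
    using LL L W unfolding J_def W_def[symmetric] V_def[symmetric]
    by (simp add: assoc_mult_mat[of _ ?K ?N _ ?N _ ?K])
  have VT: "V * T = M + 1\<^sub>m ?K"
    using V M unfolding T_def by (subst KKK[symmetric]) auto
  have "L * F = L + L * J * (T * L)"
    using L J T unfolding F by (simp add: mult_add_distrib_mat[of _ ?K ?N _ ?N] assoc_mult_mat[of _ ?K ?N _ ?K _ ?N])
  also have "L * J * (T * L) = (M + 1\<^sub>m ?K) * L"
    using V T L by (simp add: LJ VT assoc_mult_mat[of _ ?K ?K _ ?K _ ?N, symmetric])
  also have "L + (M + 1\<^sub>m ?K) * L = L + (M * L + L)"
    using M L by (simp add: add_mult_distrib_mat[of _ ?K ?K _ _ ?N])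
  \<comment> \<open>The two copies of \<open>L\<close> cancel in characteristic 2.\<close>
  also have "\<dots> = M * L"
    using M L by (intro eq_matI) (auto simp: add.left_commute)
  finally show "L * F = M * L" .
  show "H * F = H" if H: "H \<in> carrier_mat m ?N" and 0: "H * (symp_form n * transpose_mat L) = 0\<^sub>m m ?K"
  proof -
    have "H * F = H + H * J * (T * L)"
      using H L J T unfolding F by (simp add: mult_add_distrib_mat[of _ m ?N _ ?N] assoc_mult_mat[of _ m ?N _ ?K _ ?N])
    also have "H * J = 0\<^sub>m m ?K" using 0 by (simp add: J_def W_def)
    finally show ?thesis using H T L by simp
  qed
  have Jt: "transpose_mat J = R"
    using L W unfolding J_def R_def by (simp add: transpose_mult[of _ ?N ?N _ ?K])
  have Ft: "transpose_mat F = 1\<^sub>m ?N + transpose_mat L * transpose_mat T * R"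
    using L J T R Jt unfolding F
    by (simp add: transpose_add[of _ ?N ?N] transpose_mult[of _ ?N ?K _ ?N] transpose_mult[of _ ?K ?K _ ?N])
  have FW: "F * W = W + J * T * R"
    using L J T W unfolding F R_def
    by (simp add: add_mult_distrib_mat[of _ ?N ?N _ _ ?N] assoc_mult_mat[of _ ?N ?K _ ?K _ ?N]
        assoc_mult_mat[of _ ?N ?K _ ?N _ ?N] assoc_mult_mat[of _ ?K ?K _ ?N _ ?N])
  have WJ: "W * (transpose_mat L * transpose_mat T * R) = J * transpose_mat T * R"
    using L J T W R unfolding J_def
    by (simp add: assoc_mult_mat[of _ ?N ?N _ ?K _ ?N] assoc_mult_mat[of _ ?N ?N _ ?K _ ?K]  assoc_mult_mat[of _ ?N ?K _ ?K _ ?N])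
  have RL: "R * transpose_mat L = V"
    using LL unfolding R_def W_def V_def .
  \<comment> \<open>The term quadratic in \<open>T\<close>: regrouping exposes
    \<open>R * transpose_mat L\<close>, which is the Gram matrix \<open>V\<close>.\<close>
  have "J * T * R * (transpose_mat L * transpose_mat T * R) = J * T * (R * transpose_mat L) * (transpose_mat T * R)"
    using L J T R by (simp add: assoc_mult_mat[of _ ?N ?K _ ?K _ ?N] assoc_mult_mat[of _ ?N ?K _ ?K _ ?K] assoc_mult_mat[of _ ?N ?K _ ?N _ ?N] assoc_mult_mat[of _ ?N ?K _ ?N _ ?K]
        assoc_mult_mat[of _ ?K ?K _ ?K _ ?N] assoc_mult_mat[of _ ?K ?N _ ?K _ ?N] assoc_mult_mat[of _ ?K ?K _ ?N _ ?N])
  also have "\<dots> = J * (T * V * transpose_mat T) * R"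
    using J T R V by (simp add: RL assoc_mult_mat[of _ ?N ?K _ ?K _ ?N] assoc_mult_mat[of _ ?N ?K _ ?K _ ?K]
        assoc_mult_mat[of _ ?K ?K _ ?K _ ?N] KKK)
  finally have quad: "J * T * R * (transpose_mat L * transpose_mat T * R) = J * (T * V * transpose_mat T) * R" .
  have a: "V * M \<in> carrier_mat ?K ?K" and b: "transpose_mat M * V \<in> carrier_mat ?K ?K"
    using V M by auto
  have T1: "T = V * M + V"
    using V M unfolding T_def by (simp add: mult_add_distrib_mat[of _ ?K ?K _ ?K])
  have T2: "transpose_mat T = transpose_mat M * V + V"
    using V M unfolding T1 by (simp add: transpose_add[of _ ?K ?K] transpose_mult[of _ ?K ?K _ ?K])
  have "T * V = V * M * V + 1\<^sub>m ?K"
    using V M unfolding T1 by (simp add: add_mult_distrib_mat[of _ ?K ?K _ _ ?K])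
  then have "T * V * transpose_mat T = (V * M * V + 1\<^sub>m ?K) * (transpose_mat M * V + V)"
    by (simp add: T2)
  also have "\<dots> = V * (M * V * transpose_mat M) * V + transpose_mat M * V + (V * M * (V * V) + V)"
    using V(1) M by (simp add: add_mult_distrib_mat[of _ ?K ?K _ _ ?K] mult_add_distrib_mat[of _ ?K ?K _ ?K] KKK)
  \<comment> \<open>Here the symplecticity of \<open>M\<close> enters: the inner bracket is
    \<open>V\<close>, and \<open>V * V\<close> is the identity.\<close>
  also have "V * (M * V * transpose_mat M) * V = V"
    using MM V by (simp add: V_def[symmetric])
  finally have TVT: "T * V * transpose_mat T = V + transpose_mat M * V + (V * M + V)"
    using V M by simp
  have S: "T + transpose_mat T + T * V * transpose_mat T = 0\<^sub>m ?K ?K"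
  proof -
    \<comment> \<open>The bits \<open>e\<close>, \<open>f\<close>, \<open>h\<close> stand for
      entries of \<open>V * M\<close>, \<open>V\<close> and \<open>transpose_mat M * V\<close>; they
      occur two, four and two times.\<close>
    have cancel: "(e + f) + (h + f) + (f + h + (e + f)) = 0" for e f h :: bit
      by (cases e; cases f; cases h) simp_all
    show ?thesis
      unfolding TVT unfolding T2 unfolding T1 using a b V(1) 
      by (intro eq_matI) (simp_all add: cancel del: index_mult_mat(1))
  qed
  have "F * W * transpose_mat F = (W + J * T * R) * (1\<^sub>m ?N + transpose_mat L * transpose_mat T * R)"
    unfolding FW Ft ..
  also have "\<dots> = (W + J * T * R) + (J * transpose_mat T * R + J * (T * V * transpose_mat T) * R)"
  proof -
    have X: "J * T * R \<in> carrier_mat ?N ?N" "transpose_mat L * transpose_mat T * R \<in> carrier_mat ?N ?N"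
      using J T R L by auto
    show ?thesis
      using X W by (simp add: mult_add_distrib_mat[of _ ?N ?N _ ?N] add_mult_distrib_mat[of _ ?N ?N _ _ ?N]
          right_mult_one_mat[of _ ?N ?N] WJ quad)
  qed
  also have "\<dots> = W + J * (T + transpose_mat T + T * V * transpose_mat T) * R"
  proof -
    have Q: "T * V * transpose_mat T \<in> carrier_mat ?K ?K"
      using T V by auto
    have c: "J * T * R \<in> carrier_mat ?N ?N" "J * transpose_mat T * R \<in> carrier_mat ?N ?N"
      "J * (T * V * transpose_mat T) * R \<in> carrier_mat ?N ?N"
      using J T R V by auto
    have "J * (T + transpose_mat T + T * V * transpose_mat T) * R =
        J * T * R + (J * transpose_mat T * R + J * (T * V * transpose_mat T) * R)"
      using J T R Q by (simp add: mult_add_distrib_mat[of _ ?N ?K _ ?K] add_mult_distrib_mat[of _ ?N ?K _ _ ?N])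
    moreover have "A + B + (C + D) = A + (B + (C + D))"
      if "A \<in> carrier_mat ?N ?N" "B \<in> carrier_mat ?N ?N" "C \<in> carrier_mat ?N ?N" "D \<in> carrier_mat ?N ?N"
      for A B C D :: "bit mat"
      using that by (intro eq_matI) (auto simp: add.assoc)
    ultimately show ?thesis
      using c W(1) by metis
  qed
  also have "\<dots> = W"
    using J R W by (simp add: S)
  finally show "F \<in> Sp n"
    using Fc by (simp add: Sp_def W_def)
qed

section \<open>Block form of the matrix in the theorem\<close>

lemma outer_sum_altdef:
  "outer_sum n k u w = transpose_mat (mat_of_rows n (map u [0..<k])) * mat_of_rows n (map w [0..<k])"
  by (intro eq_matI) (auto simp: outer_sum_def scalar_prod_def mat_of_rows_index atLeast0LessThan)

lemma split_row_parts:
  assumes "N \<in> carrier_mat (2 * k) (2 * n)"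
  shows "N = four_block_mat
    (mat_of_rows n (map (\<lambda>i. row_part N i 0 n) [0..<k])) (mat_of_rows n (map (\<lambda>i. row_part N i n n) [0..<k]))
    (mat_of_rows n (map (\<lambda>i. row_part N (k + i) 0 n) [0..<k])) (mat_of_rows n (map (\<lambda>i. row_part N (k + i) n n) [0..<k]))"
  using assms by (intro eq_matI) (auto simp: mat_of_rows_index row_part_def)

lemma logical_mat_four_block:
  assumes "\<And>i. i < k \<Longrightarrow> lX i \<in> carrier_vec n" "\<And>i. i < k \<Longrightarrow> lZ i \<in> carrier_vec n"
  shows "logical_mat n k lX lZ = four_block_mat (mat_of_rows n (map lX [0..<k])) (0\<^sub>m k n)
    (0\<^sub>m k n) (mat_of_rows n (map lZ [0..<k]))"
proof -
  have "dim_vec (lX i) = n" "dim_vec (lZ i) = n" if "i < k" for i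
    using assms[OF that] by simp_all
  then show ?thesis
    by (intro eq_matI) (auto simp: logical_mat_def mat_of_rows_index nth_append)
qed

lemma logical_mat_carrier: "logical_mat n k lX lZ \<in> carrier_mat (2 * k) (2 * n)"
  by (intro carrier_matI) (simp_all add: logical_mat_def)

lemma symp_form_mult_transpose_logical_mat:
  assumes "\<And>i. i < k \<Longrightarrow> lX i \<in> carrier_vec n" "\<And>i. i < k \<Longrightarrow> lZ i \<in> carrier_vec n"
  shows "symp_form n * transpose_mat (logical_mat n k lX lZ) =
    four_block_mat (0\<^sub>m n k) (transpose_mat (mat_of_rows n (map lZ [0..<k])))
      (transpose_mat (mat_of_rows n (map lX [0..<k]))) (0\<^sub>m n k)"
proof -
  let ?X = "mat_of_rows n (map lX [0..<k])" and ?Z = "mat_of_rows n (map lZ [0..<k])"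
  have c: "?X \<in> carrier_mat k n" "?Z \<in> carrier_mat k n" by auto
  have "transpose_mat (logical_mat n k lX lZ) =
      four_block_mat (transpose_mat ?X) (0\<^sub>m n k) (0\<^sub>m n k) (transpose_mat ?Z)"
    using c by (simp add: logical_mat_four_block[OF assms] transpose_four_block_mat[of _ k n _ n _ k])
  then show ?thesis
    using c unfolding symp_form_def
    by (simp add: mult_four_block_mat[of _ n n _ n _ n _ _ k _ k])
qed

text \<open>Multiplication by \<open>symp_form k\<close> on the right swaps the column blocks of
  \<open>symp_form n * transpose_mat L\<close>, where \<open>L\<close> is the logical matrix,
  leaving a block diagonal matrix. So the first \<open>k\<close> rows of \<open>N\<close> are paired
  with the \<open>lZ\<close> and the last \<open>k\<close> with the \<open>lX\<close>, exactly as in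
  the outer sums.\<close>

lemma logical_symplectic_altdef:
  assumes lX: "\<And>i. i < k \<Longrightarrow> lX i \<in> carrier_vec n" and lZ: "\<And>i. i < k \<Longrightarrow> lZ i \<in> carrier_vec n"
    and M: "M \<in> carrier_mat (2 * k) (2 * k)"
  shows "logical_symplectic n k lX lZ M = 1\<^sub>m (2 * n) +
    symp_form n * transpose_mat (logical_mat n k lX lZ) * symp_form k *
      ((M + 1\<^sub>m (2 * k)) * logical_mat n k lX lZ)"
proof -
  define N where "N = (M + 1\<^sub>m (2 * k)) * logical_mat n k lX lZ"
  define X where "X = mat_of_rows n (map lX [0..<k])"
  define Z where "Z = mat_of_rows n (map lZ [0..<k])"
  define N1 where "N1 = mat_of_rows n (map (\<lambda>i. row_part N i 0 n) [0..<k])"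
  define N2 where "N2 = mat_of_rows n (map (\<lambda>i. row_part N i n n) [0..<k])"
  define N3 where "N3 = mat_of_rows n (map (\<lambda>i. row_part N (k + i) 0 n) [0..<k])"
  define N4 where "N4 = mat_of_rows n (map (\<lambda>i. row_part N (k + i) n n) [0..<k])"
  have c: "X \<in> carrier_mat k n" "Z \<in> carrier_mat k n" "N1 \<in> carrier_mat k n" "N2 \<in> carrier_mat k n"
    "N3 \<in> carrier_mat k n" "N4 \<in> carrier_mat k n"
    by (auto simp: X_def Z_def N1_def N2_def N3_def N4_def)
  have "N \<in> carrier_mat (2 * k) (2 * n)"
    unfolding N_def by (intro mult_carrier_mat[of _ _ "2 * k"] logical_mat_carrier) (use M in auto)
  then have N: "N = four_block_mat N1 N2 N3 N4"
    unfolding N1_def N2_def N3_def N4_def by (rule split_row_parts)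
  have "symp_form n * transpose_mat (logical_mat n k lX lZ) =
      four_block_mat (0\<^sub>m n k) (transpose_mat Z) (transpose_mat X) (0\<^sub>m n k)"
    unfolding X_def Z_def using lX lZ by (rule symp_form_mult_transpose_logical_mat)
  then have J: "symp_form n * transpose_mat (logical_mat n k lX lZ) * symp_form k =
      four_block_mat (transpose_mat Z) (0\<^sub>m n k) (0\<^sub>m n k) (transpose_mat X)"
    using c by (simp add: symp_form_def[of k] mult_four_block_mat[of _ n k _ k _ n _ _ k _ k])
  have JN: "four_block_mat (transpose_mat Z) (0\<^sub>m n k) (0\<^sub>m n k) (transpose_mat X) * N =
      four_block_mat (transpose_mat Z * N1) (transpose_mat Z * N2) (transpose_mat X * N3) (transpose_mat X * N4)"
    unfolding N using c by (simp add: mult_four_block_mat[of _ n k _ k _ n _ _ n _ n])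
  have "logical_symplectic n k lX lZ M = four_block_mat (1\<^sub>m n + transpose_mat Z * N1) (transpose_mat Z * N2)
      (transpose_mat X * N3) (1\<^sub>m n + transpose_mat X * N4)"
    unfolding logical_symplectic_def Let_def outer_sum_altdef
    by (simp only: N_def[symmetric] X_def[symmetric] Z_def[symmetric] N1_def[symmetric] N2_def[symmetric] N3_def[symmetric] N4_def[symmetric])
  also have "\<dots> = 1\<^sub>m (2 * n) +
      four_block_mat (transpose_mat Z * N1) (transpose_mat Z * N2) (transpose_mat X * N3) (transpose_mat X * N4)"
    \<comment> \<open>The identity of size \<open>2 * n\<close> is itself split into four blocks, so
      that the sum can be formed blockwise.\<close>
    using c add_four_block_mat[of "1\<^sub>m n" n n "0\<^sub>m n n" n "0\<^sub>m n n" n "1\<^sub>m n"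
        "transpose_mat Z * N1" "transpose_mat Z * N2" "transpose_mat X * N3" "transpose_mat X * N4"]
    by (simp add: mult_2)
  finally show ?thesis
    unfolding J N_def[symmetric] JN .
qed

section \<open>Application to CSS codes\<close>

theorem theorem3p5:
  fixes n k mX mZ :: nat
    and HX HZ M_L M_S :: "bit mat"
    and lX lZ :: "nat \<Rightarrow> bit vec"
    and g :: "complex mat"
  assumes "css_code n k mX mZ HX HZ"
    and "logical_basis n k HX HZ lX lZ"
    and "clifford_logical_operator n k HX HZ lX lZ g"
    and "logical_action n k lX lZ g M_L"
    and "stabilizer_action n k HX HZ g M_S"
    and "M_S = 1\<^sub>m (n - k)"
  shows "valid_symplectic n k HX HZ lX lZ g (logical_symplectic n k lX lZ M_L) \<and>
    logical_symplectic n k lX lZ M_L \<in> Sp n \<and>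
    logical_mat n k lX lZ * logical_symplectic n k lX lZ M_L = M_L * logical_mat n k lX lZ \<and>
    check_mat n HX HZ * logical_symplectic n k lX lZ M_L = check_mat n HX HZ"
proof -
  let ?L = "logical_mat n k lX lZ" and ?F = "logical_symplectic n k lX lZ M_L"
  let ?X = "mat_of_rows n (map lX [0..<k])" and ?Z = "mat_of_rows n (map lZ [0..<k])"
  have HX: "HX \<in> carrier_mat mX n" and HZ: "HZ \<in> carrier_mat mZ n" and m: "mX + mZ = n - k"
    using assms(1) by (auto simp: css_code_def)
  have ker: "lX i \<in> mat_kernel HZ" "lZ i \<in> mat_kernel HX" if "i < k" for i
    using assms(2) that by (auto simp: logical_basis_def represents_quotient_basis_def)
  have lX: "lX i \<in> carrier_vec n" "HZ *\<^sub>v lX i = 0\<^sub>v mZ" if "i < k" for i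
    using mat_kernelD[OF HZ ker(1)[OF that]] by auto
  have lZ: "lZ i \<in> carrier_vec n" "HX *\<^sub>v lZ i = 0\<^sub>v mX" if "i < k" for i
    using mat_kernelD[OF HX ker(2)[OF that]] by auto
  have M: "M_L \<in> carrier_mat (2 * k) (2 * k)"
    using assms(4) by (simp add: logical_action_def)
  have L: "?L \<in> carrier_mat (2 * k) (2 * n)"
    by (rule logical_mat_carrier)
  \<comment> \<open>Both are the duality of the logical basis; the second uses the symmetry of the
    dot product.\<close>
  have XZ: "?X * transpose_mat ?Z = 1\<^sub>m k" "?Z * transpose_mat ?X = 1\<^sub>m k"
    using assms(2) lX lZ
    by (auto intro!: eq_matI simp: logical_basis_def comm_scalar_prod[of "lZ _" n])
  \<comment> \<open>The entries are those of \<open>HX *\<^sub>v lZ j\<close> and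
    \<open>HZ *\<^sub>v lX j\<close>, which vanish by kernel membership.\<close>
  have HL: "HX * transpose_mat ?Z = 0\<^sub>m mX k" "HZ * transpose_mat ?X = 0\<^sub>m mZ k"
  proof -
    have "row HX i \<bullet> lZ j = 0" if "i < mX" "j < k" for i j
      using arg_cong[OF lZ(2)[OF that(2)], of "\<lambda>v. v $ i"] that HX by simp
    then show "HX * transpose_mat ?Z = 0\<^sub>m mX k"
      using HX lZ by (intro eq_matI) auto
    have "row HZ i \<bullet> lX j = 0" if "i < mZ" "j < k" for i j
      using arg_cong[OF lX(2)[OF that(2)], of "\<lambda>v. v $ i"] that HZ by simp
    then show "HZ * transpose_mat ?X = 0\<^sub>m mZ k"
      using HZ lX by (intro eq_matI) auto
  qed
  have c: "?X \<in> carrier_mat k n" "?Z \<in> carrier_mat k n" by auto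
  have J: "symp_form n * transpose_mat ?L =
      four_block_mat (0\<^sub>m n k) (transpose_mat ?Z) (transpose_mat ?X) (0\<^sub>m n k)"
    using lX lZ by (intro symp_form_mult_transpose_logical_mat) auto
  have L4: "?L = four_block_mat ?X (0\<^sub>m k n) (0\<^sub>m k n) ?Z"
    using lX lZ by (intro logical_mat_four_block) auto
  have "?L * (symp_form n * transpose_mat ?L) = symp_form k"
    unfolding J unfolding L4 using c by (simp add: mult_four_block_mat[of _ k n _ n _ k _ _ k _ k] XZ symp_form_def)
  then have LL: "?L * symp_form n * transpose_mat ?L = symp_form k"
    using L by (simp add: assoc_mult_mat[of _ "2 * k" "2 * n" _ "2 * n" _ "2 * k"])
  have H: "check_mat n HX HZ \<in> carrier_mat (n - k) (2 * n)"
    using HX HZ m four_block_carrier_mat[OF HX HZ] by (simp add: check_mat_def mult_2)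
  \<comment> \<open>The form pairs \<open>HX\<close> with the \<open>lZ\<close> and
    \<open>HZ\<close> with the \<open>lX\<close>, so only the products in \<open>HL\<close>
    survive.\<close>
  have HJ: "check_mat n HX HZ * (symp_form n * transpose_mat ?L) = 0\<^sub>m (n - k) (2 * k)"
    unfolding J check_mat_def using HX HZ c
    by (simp add: mult_four_block_mat[of _ mX n _ n _ mZ _ _ k _ k] HL m[symmetric] mult_2)
  \<comment> \<open>One enumeration of all \<open>2 * k\<close> logical generators in the row order
    of \<open>?L\<close>, so that Gram matrices can be compared entry by entry without splitting
    into X and Z cases.\<close>
  define P where "P i = (if i < k then logical_X n lX i else logical_Z n lZ (i - k))" for i
  have P: "P i \<in> pauli_set n" if "i < 2 * k" for i
    using that lX lZ by (auto simp: P_def logical_X_def logical_Z_def intro!: pauli_D_in_pauli_set)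
  have phi_P: "pauli_phi n (P i) = row ?L i" if "i < 2 * k" for i
  proof -
    have "row ?L i = (if i < k then lX i @\<^sub>v 0\<^sub>v n else 0\<^sub>v n @\<^sub>v lZ (i - k))"
      unfolding logical_mat_def using that lX lZ
      by (subst mat_of_rows_row) (auto simp: nth_append mult_2)
    with that lX lZ show ?thesis
      by (auto simp: P_def logical_X_def logical_Z_def pauli_phi_pauli_D)
  qed
  have phi_conj: "pauli_phi n (conj_by g (P i)) = row (M_L * ?L) i" if "i < 2 * k" for i
  proof (cases "i < k")
    case False
    then have "i - k < k" "k + (i - k) = i" using that by auto
    then show ?thesis using assms(4) False by (metis P_def logical_action_def)
  qed (use assms(4) in \<open>auto simp: P_def logical_action_def\<close>)
  have g: "clifford_unitary n g"
    using assms(3) by (simp add: clifford_logical_operator_def)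
  have RL: "M_L * ?L \<in> carrier_mat (2 * k) (2 * n)"
    using M L by simp
  \<comment> \<open>Row \<open>i\<close> on the left is the image of \<open>conj_by g (P i)\<close>
    and on the right that of \<open>P i\<close>; conjugation preserves their symplectic
    products.\<close>
  have "M_L * ?L * symp_form n * transpose_mat (M_L * ?L) = ?L * symp_form n * transpose_mat ?L"
  proof (rule eq_matI)
    fix i j
    assume "i < dim_row (?L * symp_form n * transpose_mat ?L)" "j < dim_col (?L * symp_form n * transpose_mat ?L)"
    then have ij: "i < 2 * k" "j < 2 * k" using L by auto
    show "(M_L * ?L * symp_form n * transpose_mat (M_L * ?L)) $$ (i, j) =
        (?L * symp_form n * transpose_mat ?L) $$ (i, j)"
      using pauli_phi_conj_by[OF g P P, of i j] ij
      unfolding mult_symp_form_mult_transpose_index[OF L ij] mult_symp_form_mult_transpose_index[OF RL ij]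
      by (simp add: phi_P phi_conj)
  qed (use M L in auto)
  moreover have "M_L * ?L * symp_form n * transpose_mat (M_L * ?L) =
      M_L * (?L * symp_form n * transpose_mat ?L) * transpose_mat M_L"
  proof -
    have "symp_form n * transpose_mat ?L \<in> carrier_mat (2 * n) (2 * k)"
      and "?L * (symp_form n * transpose_mat ?L) \<in> carrier_mat (2 * k) (2 * k)"
      using mult_carrier_mat[OF symp_form_carrier, of "transpose_mat ?L" n "2 * k"]
        mult_carrier_mat[OF L, of "symp_form n * transpose_mat ?L" "2 * k"] L by auto
    with M L show ?thesis
      by (simp add: transpose_mult[of _ "2 * k" "2 * k" _ "2 * n"]
        assoc_mult_mat[of _ "2 * k" "2 * k" _ "2 * n" _ "2 * n"] assoc_mult_mat[of _ "2 * k" "2 * k" _ "2 * k" _ "2 * k"]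
        assoc_mult_mat[of _ "2 * k" "2 * k" _ "2 * n" _ "2 * k"] assoc_mult_mat[of _ "2 * k" "2 * n" _ "2 * n" _ "2 * k"]
        assoc_mult_mat[of _ "2 * k" "2 * n" _ "2 * k" _ "2 * k"] assoc_mult_mat[of _ "2 * n" "2 * n" _ "2 * k" _ "2 * k"])
  qed
  ultimately have MM: "M_L * symp_form k * transpose_mat M_L = symp_form k"
    by (simp add: LL)
  have F: "?F = 1\<^sub>m (2 * n) + symp_form n * transpose_mat ?L * symp_form k * ((M_L + 1\<^sub>m (2 * k)) * ?L)"
    using lX lZ M by (intro logical_symplectic_altdef) auto
  note main = symplectic_extension[OF L LL M MM F]
  have HF: "check_mat n HX HZ * ?F = check_mat n HX HZ"
    using H HJ by (rule main(3))
  \<comment> \<open>With \<open>M_S\<close> the identity, the invariance of the check matrix becomes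
    the relation that \<open>valid_symplectic\<close> demands, with \<open>M_S\<close> as
    witness.\<close>
  moreover have "check_mat n HX HZ * ?F = M_S * check_mat n HX HZ"
    using H by (simp add: HF assms(6))
  ultimately show ?thesis
    using main(1,2) HF assms(4,5) unfolding valid_symplectic_def by blast
qed

end
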